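(* Let $\Lambda$ be a monotone modal logic which is $\sigma$-canonical or $\pi$-canonical and which is preserved under bisimulation products. Then $\Lambda$ has the Lyndon positivity property (LPP).
   Context: Formulas. Fix a countably infinite set $\mathcal V$ of propositional variables. A literal is a variable $p$ or its negation $\neg p$. Modal formulas (set $\mathrm{Fm}$) are built from literals and $\bot,\top$ using $\wedge,\vee,\Diamond,\Box$; negation of an arbitrary formula is defined by the duality laws, and $\varphi\to\psi$ is $\neg\varphi\vee\psi$. $\mathrm{lits}(\varphi)$ is the set of literals occurring in $\varphi$. $\varphi(\vec p,\bar r)$ means that all variables of $\varphi$ are among $\vec p,\bar r$; substitution is simultaneous with negations expanded. Logics. A modal logic is a set $\Lambda\subseteq\mathrm{Fm}$ containing all classical tautologies and closed under modus ponens, uniform substitution and the rule: from $\varphi\leftrightarrow\psi$ infer $\Diamond\varphi\leftrightarrow\Diamond\psi$. $\Lambda\vdash\varphi$ means $\varphi\in\Lambda$. $\Lambda$ is monotone if it contains $\Diamond p\to\Diamond(p\vee q)$. LPP. Let $\vec p=(p_i)_{i<n}$, $\bar r=(r_j)_{j<m}$ be finite tuples of pairwise distinct variables. A formula $\varphi(\vec p,\bar r)$ is $\vec p$-positive if no $\neg p_i$ is in $\mathrm{lits}(\varphi)$. It is $\vec p$-monotone in $\Lambda$ if $\Lambda\vdash\varphi(\vec p,\bar r)\to\varphi(\vec p\vee\vec q,\bar r)$, where $\vec q=(q_i)_{i<n}$ is a tuple of fresh distinct variables and $\vec p\vee\vec q=(p_i\vee q_i)_{i<n}$. A monotone logic $\Lambda$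 has LPP if for all such $\vec p,\bar r$, every formula $\varphi(\vec p,\bar r)$ that is $\vec p$-monotone in $\Lambda$ is $\Lambda$-equivalent (i.e. $\Lambda\vdash\varphi\leftrightarrow\alpha$) to some $\vec p$-positive formula $\alpha(\vec p,\bar r)$. Neighborhood frames. A neighborhood frame is a pair $\mathfrak F=(W,\Diamond)$ with $\Diamond:\mathcal P(W)\to\mathcal P(W)$; $\Box X=W\setminus\Diamond(W\setminus X)$. A valuation $\vartheta:\mathcal V\to\mathcal P(W)$ extends to all formulas, interpreting the Boolean connectives set-theoretically and $\Diamond,\Box$ by these operators. $\varphi$ is valid in $\mathfrak F$ if $\vartheta(\varphi)=W$ for all $\vartheta$; $\mathfrak F$ is a $\Lambda$-frame if all formulas of $\Lambda$ are valid in it. $\mathfrak F$ is monotone if $X\subseteq Y$ implies $\Diamond X\subseteq\Diamond Y$. Bisimulation products. For $Z\subseteq W_1\times W_2$, $Z(X_1)$ denotes the image of $X_1\subseteq W_1$ and $Z^{-1}(X_2)$ the preimage of $X_2\subseteq W_2$; $Z$ is full if $Z^{-1}(W_2)=W_1$ and $Z(W_1)=W_2$. $Z$ is a bisimulation between monotone frames $\mathfrak F_k=(W_k,\Diamond_k)$, $k=1,2$, if $Z(\Diamond_1X_1)\subseteq\Diamond_2Z(X_1)$ for all $X_1\subseteq W_1$ and $Z^{-1}(\Diamond_2X_2)\subseteq\Diamond_1Z^{-1}(X_2)$ for all $X_2\subseteq W_2$. If $Z$ is a full bisimulation, a frame $\mathfrak F=(Z,\Diamond)$ is a bisimulation product of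 $\mathfrak F_1$ and $\mathfrak F_2$ if for $k=1,2$ and all $X_k\subseteq W_k$, $\Diamond\pi_k^{-1}(X_k)=\pi_k^{-1}(\Diamond_kX_k)$, where $\pi_k:Z\to W_k$, $(w_1,w_2)\mapsto w_k$. $\Lambda$ is preserved under bisimulation products if for every full bisimulation $Z$ between $\Lambda$-frames $\mathfrak F_1,\mathfrak F_2$ there is an operator $\Diamond$ on $\mathcal P(Z)$ such that $(Z,\Diamond)$ is a bisimulation product of $\mathfrak F_1$ and $\mathfrak F_2$ and is a $\Lambda$-frame. Canonicity. For a monotone logic $\Lambda$, $\Gamma\subseteq\mathrm{Fm}$ is $\Lambda$-consistent if there is no finite $\Gamma_0\subseteq\Gamma$ with $\Lambda\vdash\bigwedge\Gamma_0\to\bot$. $W_\Lambda$ is the collection of all maximal $\Lambda$-consistent sets; for $\Gamma\subseteq\mathrm{Fm}$, $[\![\Gamma]\!]=\{w\in W_\Lambda\mid\Gamma\subseteq w\}$ and $[\![\varphi]\!]=[\![\{\varphi\}]\!]$. For $X\subseteq W_\Lambda$ (with $\Gamma$ ranging over sets of formulas, $\varphi$ over formulas, and $-Y=W_\Lambda\setminus Y$), $$\Diamond^\sigma_\Lambda X=\bigcup_{\Gamma:[\![\Gamma]\!]\subseteq X}\ \bigcap_{\varphi:[\![\Gamma]\!]\subseteq[\![\varphi]\!]}[\![\Diamond\varphi]\!],\qquad \Diamond^\pi_\Lambda X=\bigcap_{\Gamma:X\subseteq-[\![\Gamma]\!]}\ \bigcup_{\varphi:[\![\varphi]\!]\subseteq-[\![\Gamma]\!]}[\![\Diamond\varphi]\!].$$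 $\mathfrak F^\sigma_\Lambda=(W_\Lambda,\Diamond^\pi_\Lambda)$ and $\mathfrak F^\pi_\Lambda=(W_\Lambda,\Diamond^\sigma_\Lambda)$ (the interchange of superscripts is intended). $\Lambda$ is $\sigma$-canonical if $\mathfrak F^\sigma_\Lambda$ is a $\Lambda$-frame, and $\pi$-canonical if $\mathfrak F^\pi_\Lambda$ is a $\Lambda$-frame. *)

theory Defs
  imports Main
begin

section \<open>Formulas\<close>

type_synonym var = nat

datatype lit = Pos var | Neg var

datatype fm =
    Lit lit
  | Bot
  | Top
  | And fm fm
  | Or fm fm
  | Dia fm
  | Box fm

abbreviation Var :: "var \<Rightarrow> fm" where
  "Var p \<equiv> Lit (Pos p)"

primrec neg_lit :: "lit \<Rightarrow> lit" where
  "neg_lit (Pos p) = Neg p"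
| "neg_lit (Neg p) = Pos p"

primrec neg :: "fm \<Rightarrow> fm" where
  "neg (Lit l) = Lit (neg_lit l)"
| "neg Bot = Top"
| "neg Top = Bot"
| "neg (And \<phi> \<psi>) = Or (neg \<phi>) (neg \<psi>)"
| "neg (Or \<phi> \<psi>) = And (neg \<phi>) (neg \<psi>)"
| "neg (Dia \<phi>) = Box (neg \<phi>)"
| "neg (Box \<phi>) = Dia (neg \<phi>)"

definition Imp :: "fm \<Rightarrow> fm \<Rightarrow> fm" where
  "Imp \<phi> \<psi> = Or (neg \<phi>) \<psi>"

definition Iff :: "fm \<Rightarrow> fm \<Rightarrow> fm" where
  "Iff \<phi> \<psi> = And (Imp \<phi> \<psi>) (Imp \<psi> \<phi>)"

primrec lits :: "fm \<Rightarrow> lit set" where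
  "lits (Lit l) = {l}"
| "lits Bot = {}"
| "lits Top = {}"
| "lits (And \<phi> \<psi>) = lits \<phi> \<union> lits \<psi>"
| "lits (Or \<phi> \<psi>) = lits \<phi> \<union> lits \<psi>"
| "lits (Dia \<phi>) = lits \<phi>"
| "lits (Box \<phi>) = lits \<phi>"

definition vars :: "fm \<Rightarrow> var set" where
  "vars \<phi> = {p. Pos p \<in> lits \<phi> \<or> Neg p \<in> lits \<phi>}"

primrec subst_lit :: "(var \<Rightarrow> fm) \<Rightarrow> lit \<Rightarrow> fm" where
  "subst_lit s (Pos p) = s p"
| "subst_lit s (Neg p) = neg (s p)"

primrec subst :: "(var \<Rightarrow> fm) \<Rightarrow> fm \<Rightarrow> fm" where
  "subst s (Lit l) = subst_lit s l"
| "subst s Bot = Bot"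
| "subst s Top = Top"
| "subst s (And \<phi> \<psi>) = And (subst s \<phi>) (subst s \<psi>)"
| "subst s (Or \<phi> \<psi>) = Or (subst s \<phi>) (subst s \<psi>)"
| "subst s (Dia \<phi>) = Dia (subst s \<phi>)"
| "subst s (Box \<phi>) = Box (subst s \<phi>)"


section \<open>Logics\<close>

primrec lit_true :: "(var \<Rightarrow> bool) \<Rightarrow> lit \<Rightarrow> bool" where
  "lit_true v (Pos p) = v p"
| "lit_true v (Neg p) = (\<not> v p)"

text \<open>Boolean truth assignments to modal formulas: \<open>m \<phi>\<close> is an arbitrary truth value for \<open>Dia \<phi>\<close>,
  and \<open>Box \<phi>\<close> is read as the negation of \<open>Dia (neg \<phi>)\<close>. The tautologies are thus the
  substitution instances of the modality-free ones.\<close>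

primrec bool_true :: "(var \<Rightarrow> bool) \<Rightarrow> (fm \<Rightarrow> bool) \<Rightarrow> fm \<Rightarrow> bool" where
  "bool_true v m (Lit l) = lit_true v l"
| "bool_true v m Bot = False"
| "bool_true v m Top = True"
| "bool_true v m (And \<phi> \<psi>) = (bool_true v m \<phi> \<and> bool_true v m \<psi>)"
| "bool_true v m (Or \<phi> \<psi>) = (bool_true v m \<phi> \<or> bool_true v m \<psi>)"
| "bool_true v m (Dia \<phi>) = m \<phi>"
| "bool_true v m (Box \<phi>) = (\<not> m (neg \<phi>))"

definition tautology :: "fm \<Rightarrow> bool" where
  "tautology \<phi> \<longleftrightarrow> (\<forall>v m. bool_true v m \<phi>)"

definition modal_logic :: "fm set \<Rightarrow> bool" where
  "modal_logic L \<longleftrightarrow>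
     (\<forall>\<phi>. tautology \<phi> \<longrightarrow> \<phi> \<in> L) \<and>
     (\<forall>\<phi> \<psi>. \<phi> \<in> L \<longrightarrow> Imp \<phi> \<psi> \<in> L \<longrightarrow> \<psi> \<in> L) \<and>
     (\<forall>\<phi> s. \<phi> \<in> L \<longrightarrow> subst s \<phi> \<in> L) \<and>
     (\<forall>\<phi> \<psi>. Iff \<phi> \<psi> \<in> L \<longrightarrow> Iff (Dia \<phi>) (Dia \<psi>) \<in> L)"

definition monotone_logic :: "fm set \<Rightarrow> bool" where
  "monotone_logic L \<longleftrightarrow> modal_logic L \<and>
     (\<forall>p q. p \<noteq> q \<longrightarrow> Imp (Dia (Var p)) (Dia (Or (Var p) (Var q))) \<in> L)"


section \<open>The Lyndon positivity property\<close>

definition positive_in :: "var list \<Rightarrow> fm \<Rightarrow> bool" where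
  "positive_in ps \<phi> \<longleftrightarrow> (\<forall>p\<in>set ps. Neg p \<notin> lits \<phi>)"

definition join_subst :: "var list \<Rightarrow> var list \<Rightarrow> var \<Rightarrow> fm" where
  "join_subst ps qs v =
     (case map_of (zip ps qs) v of None \<Rightarrow> Var v | Some q \<Rightarrow> Or (Var v) (Var q))"

text \<open>As a logic is closed under substitution, the choice of the fresh tuple \<open>qs\<close> is immaterial.\<close>

definition monotone_in :: "fm set \<Rightarrow> var list \<Rightarrow> var list \<Rightarrow> fm \<Rightarrow> bool" where
  "monotone_in L ps rs \<phi> \<longleftrightarrow>
     (\<exists>qs. length qs = length ps \<and> distinct qs \<and> set qs \<inter> (set ps \<union> set rs) = {} \<and>
           Imp \<phi> (subst (join_subst ps qs) \<phi>) \<in> L)"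

definition LPP :: "fm set \<Rightarrow> bool" where
  "LPP L \<longleftrightarrow>
     (\<forall>ps rs \<phi>. distinct (ps @ rs) \<longrightarrow> vars \<phi> \<subseteq> set (ps @ rs) \<longrightarrow> monotone_in L ps rs \<phi> \<longrightarrow>
        (\<exists>\<alpha>. vars \<alpha> \<subseteq> set (ps @ rs) \<and> positive_in ps \<alpha> \<and> Iff \<phi> \<alpha> \<in> L))"


section \<open>Neighborhood frames\<close>

text \<open>Only the values of \<open>dia\<close> on subsets of \<open>worlds\<close> are meaningful.\<close>

record 'w nframe =
  worlds :: "'w set"
  dia :: "'w set \<Rightarrow> 'w set"

definition is_nframe :: "'w nframe \<Rightarrow> bool" where
  "is_nframe F \<longleftrightarrow> (\<forall>X. X \<subseteq> worlds F \<longrightarrow> dia F X \<subseteq> worlds F)"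

definition box :: "'w nframe \<Rightarrow> 'w set \<Rightarrow> 'w set" where
  "box F X = worlds F - dia F (worlds F - X)"

primrec sem_lit :: "'w nframe \<Rightarrow> (var \<Rightarrow> 'w set) \<Rightarrow> lit \<Rightarrow> 'w set" where
  "sem_lit F \<theta> (Pos p) = \<theta> p"
| "sem_lit F \<theta> (Neg p) = worlds F - \<theta> p"

primrec sem :: "'w nframe \<Rightarrow> (var \<Rightarrow> 'w set) \<Rightarrow> fm \<Rightarrow> 'w set" where
  "sem F \<theta> (Lit l) = sem_lit F \<theta> l"
| "sem F \<theta> Bot = {}"
| "sem F \<theta> Top = worlds F"
| "sem F \<theta> (And \<phi> \<psi>) = sem F \<theta> \<phi> \<inter> sem F \<theta> \<psi>"
| "sem F \<theta> (Or \<phi> \<psi>) = sem F \<theta> \<phi> \<union> sem F \<theta> \<psi>"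
| "sem F \<theta> (Dia \<phi>) = dia F (sem F \<theta> \<phi>)"
| "sem F \<theta> (Box \<phi>) = box F (sem F \<theta> \<phi>)"

definition valid :: "'w nframe \<Rightarrow> fm \<Rightarrow> bool" where
  "valid F \<phi> \<longleftrightarrow> (\<forall>\<theta>. (\<forall>p. \<theta> p \<subseteq> worlds F) \<longrightarrow> sem F \<theta> \<phi> = worlds F)"

definition logic_frame :: "fm set \<Rightarrow> 'w nframe \<Rightarrow> bool" where
  "logic_frame L F \<longleftrightarrow> is_nframe F \<and> (\<forall>\<phi>\<in>L. valid F \<phi>)"

definition monotone_frame :: "'w nframe \<Rightarrow> bool" where
  "monotone_frame F \<longleftrightarrow> is_nframe F \<and>
     (\<forall>X Y. X \<subseteq> Y \<longrightarrow> Y \<subseteq> worlds F \<longrightarrow> dia F X \<subseteq> dia F Y)"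


section \<open>Bisimulation products\<close>

definition bisimulation :: "'a nframe \<Rightarrow> 'b nframe \<Rightarrow> ('a \<times> 'b) set \<Rightarrow> bool" where
  "bisimulation F1 F2 Z \<longleftrightarrow>
     monotone_frame F1 \<and> monotone_frame F2 \<and> Z \<subseteq> worlds F1 \<times> worlds F2 \<and>
     (\<forall>X1. X1 \<subseteq> worlds F1 \<longrightarrow> Z `` dia F1 X1 \<subseteq> dia F2 (Z `` X1)) \<and>
     (\<forall>X2. X2 \<subseteq> worlds F2 \<longrightarrow> converse Z `` dia F2 X2 \<subseteq> dia F1 (converse Z `` X2))"

definition full_bisimulation :: "'a nframe \<Rightarrow> 'b nframe \<Rightarrow> ('a \<times> 'b) set \<Rightarrow> bool" where
  "full_bisimulation F1 F2 Z \<longleftrightarrow> bisimulation F1 F2 Z \<and>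
     converse Z `` worlds F2 = worlds F1 \<and> Z `` worlds F1 = worlds F2"

definition bisimulation_product ::
    "'a nframe \<Rightarrow> 'b nframe \<Rightarrow> ('a \<times> 'b) set \<Rightarrow> ('a \<times> 'b) nframe \<Rightarrow> bool" where
  "bisimulation_product F1 F2 Z F \<longleftrightarrow>
     full_bisimulation F1 F2 Z \<and> is_nframe F \<and> worlds F = Z \<and>
     (\<forall>X1. X1 \<subseteq> worlds F1 \<longrightarrow> dia F {z \<in> Z. fst z \<in> X1} = {z \<in> Z. fst z \<in> dia F1 X1}) \<and>
     (\<forall>X2. X2 \<subseteq> worlds F2 \<longrightarrow> dia F {z \<in> Z. snd z \<in> X2} = {z \<in> Z. snd z \<in> dia F2 X2})"

text \<open>HOL cannot quantify over all types, so the definition is relative to a type \<open>'w\<close>: it concerns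
  all frames whose sets of worlds are subsets of \<open>'w\<close>.\<close>

definition preserved_under_bisimulation_products :: "'w itself \<Rightarrow> fm set \<Rightarrow> bool" where
  "preserved_under_bisimulation_products (_ :: 'w itself) L \<longleftrightarrow>
     (\<forall>(F1 :: 'w nframe) (F2 :: 'w nframe) Z.
        logic_frame L F1 \<longrightarrow> logic_frame L F2 \<longrightarrow> full_bisimulation F1 F2 Z \<longrightarrow>
        (\<exists>F. bisimulation_product F1 F2 Z F \<and> logic_frame L F))"


section \<open>Canonicity\<close>

definition Conj :: "fm list \<Rightarrow> fm" where
  "Conj \<phi>s = foldr And \<phi>s Top"

definition consistent :: "fm set \<Rightarrow> fm set \<Rightarrow> bool" where
  "consistent L \<Gamma> \<longleftrightarrow> \<not> (\<exists>\<phi>s. set \<phi>s \<subseteq> \<Gamma> \<and> Imp (Conj \<phi>s) Bot \<in> L)"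

definition canon_worlds :: "fm set \<Rightarrow> fm set set" where
  "canon_worlds L = {w. consistent L w \<and> (\<forall>w'. consistent L w' \<longrightarrow> w \<subseteq> w' \<longrightarrow> w' = w)}"

definition ext_set :: "fm set \<Rightarrow> fm set \<Rightarrow> fm set set" where
  "ext_set L \<Gamma> = {w \<in> canon_worlds L. \<Gamma> \<subseteq> w}"

definition ext :: "fm set \<Rightarrow> fm \<Rightarrow> fm set set" where
  "ext L \<phi> = ext_set L {\<phi>}"

text \<open>The outer and inner intersections below are over nonempty families if \<open>L\<close> is a logic, so they
  yield subsets of \<open>canon_worlds L\<close>.\<close>

definition dia_sigma :: "fm set \<Rightarrow> fm set set \<Rightarrow> fm set set" where
  "dia_sigma L X =
     (\<Union>\<Gamma>\<in>{\<Gamma>. ext_set L \<Gamma> \<subseteq> X}. \<Inter>\<phi>\<in>{\<phi>. ext_set L \<Gamma> \<subseteq> ext L \<phi>}. ext L (Dia \<phi>))"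

definition dia_pi :: "fm set \<Rightarrow> fm set set \<Rightarrow> fm set set" where
  "dia_pi L X =
     (\<Inter>\<Gamma>\<in>{\<Gamma>. X \<subseteq> canon_worlds L - ext_set L \<Gamma>}.
        \<Union>\<phi>\<in>{\<phi>. ext L \<phi> \<subseteq> canon_worlds L - ext_set L \<Gamma>}. ext L (Dia \<phi>))"

text \<open>The superscripts are interchanged on purpose: the \<open>\<sigma>\<close>-frame carries the \<open>\<pi>\<close>-operator and
  vice versa.\<close>

definition canon_frame_sigma :: "fm set \<Rightarrow> fm set nframe" where
  "canon_frame_sigma L = \<lparr>worlds = canon_worlds L, dia = dia_pi L\<rparr>"

definition canon_frame_pi :: "fm set \<Rightarrow> fm set nframe" where
  "canon_frame_pi L = \<lparr>worlds = canon_worlds L, dia = dia_sigma L\<rparr>"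

definition sigma_canonical :: "fm set \<Rightarrow> bool" where
  "sigma_canonical L \<longleftrightarrow> logic_frame L (canon_frame_sigma L)"

definition pi_canonical :: "fm set \<Rightarrow> bool" where
  "pi_canonical L \<longleftrightarrow> logic_frame L (canon_frame_pi L)"

end

theory Submission
  imports Defs
begin

text \<open>Fix a tuple \<open>ps\<close>, a tuple \<open>rs\<close> and a formula \<open>\<phi>\<close> that is \<open>ps\<close>-monotone in \<open>L\<close>. Relate two worlds
  \<open>w\<close>, \<open>v\<close> of the canonical model, \<open>w Z v\<close>, if \<open>v\<close> contains every \<open>ps\<close>-positive formula over
  \<open>ps, rs\<close> that \<open>w\<close> contains. The formulas that are equivalent to such a positive formula are
  exactly those whose truth set is closed under \<open>Z\<close>; this is a compactness argument
  (\<open>definable_in_fragment\<close>). So it suffices that \<open>\<phi> \<in> w\<close> and \<open>w Z v\<close> imply \<open>\<phi> \<in> v\<close>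
  (\<open>ext_closed_if_monotone_in\<close>).

  The relation \<open>Z\<close> is a full bisimulation of the canonical frame with itself, for the operator
  \<open>dia_sigma\<close> as well as for \<open>dia_pi\<close>. Positive formulas are closed under the modalities, and
  compactness shows that \<open>Z\<close> maps the closed set defined by \<open>\<Gamma>\<close> onto the closed set defined by the
  positive consequences of \<open>\<Gamma>\<close> (\<open>fragment_rel_image_ext_set\<close>); both operators are computed from
  closed sets. The converse of \<open>Z\<close> is the relation of the same kind for the negations of positive
  formulas, so every argument about \<open>Z\<close> is carried out for an arbitrary fragment and then also
  holds for the converse.

  By canonicity the canonical frame is an \<open>L\<close>-frame, so \<open>Z\<close> carries a bisimulation product
  that is an \<open>L\<close>-frame. The canonical valuation pulls back to it along the two projections, and the
  pulled back truth sets of \<open>\<phi>\<close> are those pairs whose first, respectively second, component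
  contains \<open>\<phi>\<close>. On \<open>rs\<close> the two pulled back valuations agree, since \<open>r\<close> and its negation are both
  positive; on \<open>ps\<close> the first is below the second. Hence the second one is the join of the
  first with suitable values of the fresh variables, and the validity of
  \<open>\<phi>(ps, rs) \<rightarrow> \<phi>(ps \<or> qs, rs)\<close> in the product transfers \<open>\<phi>\<close> from the first component of each pair
  in \<open>Z\<close> to the second.\<close>

section \<open>Duality and Boolean reasoning\<close>

lemma neg_neg [simp]: "neg (neg \<phi>) = \<phi>"
proof (induction \<phi>)
  case (Lit l)
  then show ?case by (cases l) auto
qed auto

lemma subst_neg: "subst s (neg \<phi>) = neg (subst s \<phi>)"
proof (induction \<phi>)
  case (Lit l)
  then show ?case by (cases l) auto
qed auto

lemma bool_true_neg [simp]: "bool_true v m (neg \<phi>) \<longleftrightarrow> \<not> bool_true v m \<phi>"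
proof (induction \<phi>)
  case (Lit l)
  then show ?case by (cases l) auto
qed auto

lemma bool_true_Imp [simp]: "bool_true v m (Imp \<phi> \<psi>) \<longleftrightarrow> (bool_true v m \<phi> \<longrightarrow> bool_true v m \<psi>)"
  by (auto simp: Imp_def)

lemma bool_true_Iff [simp]: "bool_true v m (Iff \<phi> \<psi>) \<longleftrightarrow> (bool_true v m \<phi> \<longleftrightarrow> bool_true v m \<psi>)"
  by (auto simp: Iff_def)

lemma bool_true_Conj [simp]: "bool_true v m (Conj \<phi>s) \<longleftrightarrow> (\<forall>\<chi>\<in>set \<phi>s. bool_true v m \<chi>)"
  by (induction \<phi>s) (auto simp: Conj_def)

definition derives :: "fm set \<Rightarrow> fm set \<Rightarrow> fm \<Rightarrow> bool" where
  "derives L \<Gamma> \<phi> \<longleftrightarrow> (\<exists>\<phi>s. set \<phi>s \<subseteq> \<Gamma> \<and> Imp (Conj \<phi>s) \<phi> \<in> L)"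

lemma consistent_iff_derives: "consistent L \<Gamma> \<longleftrightarrow> \<not> derives L \<Gamma> Bot"
  by (simp add: consistent_def derives_def)

lemma derives_mono: "derives L \<Gamma> \<phi> \<Longrightarrow> \<Gamma> \<subseteq> \<Delta> \<Longrightarrow> derives L \<Delta> \<phi>"
  unfolding derives_def by blast

locale modal =
  fixes L :: "fm set"
  assumes modal_L: "modal_logic L"
begin

lemma tautology_in: "(\<And>v m. bool_true v m \<phi>) \<Longrightarrow> \<phi> \<in> L"
  using modal_L unfolding modal_logic_def tautology_def by blast

lemma modus_ponens: "\<phi> \<in> L \<Longrightarrow> Imp \<phi> \<psi> \<in> L \<Longrightarrow> \<psi> \<in> L"
  using modal_L unfolding modal_logic_def by blast

lemma subst_in: "\<phi> \<in> L \<Longrightarrow> subst s \<phi> \<in> L"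
  using modal_L unfolding modal_logic_def by blast

lemma Dia_congruence: "Iff \<phi> \<psi> \<in> L \<Longrightarrow> Iff (Dia \<phi>) (Dia \<psi>) \<in> L"
  using modal_L unfolding modal_logic_def by blast

text \<open>This lets a purely Boolean step be justified by truth assignments instead of an explicit
  chain of axioms.\<close>

lemma tautological_consequence:
  assumes "set \<chi>s \<subseteq> L" "\<And>v m. \<forall>\<chi>\<in>set \<chi>s. bool_true v m \<chi> \<Longrightarrow> bool_true v m \<psi>"
  shows "\<psi> \<in> L"
  using assms
proof (induction \<chi>s arbitrary: \<psi>)
  case Nil
  then show ?case by (auto intro: tautology_in)
next
  case (Cons \<chi> \<chi>s)
  have "Imp \<chi> \<psi> \<in> L"
    by (rule Cons.IH) (use Cons.prems in auto)
  with Cons.prems(1) show ?case by (intro modus_ponens[of \<chi> \<psi>]) auto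
qed

lemma derives_member: "\<phi> \<in> \<Gamma> \<Longrightarrow> derives L \<Gamma> \<phi>"
  unfolding derives_def by (rule exI[of _ "[\<phi>]"]) (auto intro: tautology_in)

lemma derives_logic: "\<phi> \<in> L \<Longrightarrow> derives L \<Gamma> \<phi>"
  unfolding derives_def
  by (intro exI[of _ "[]"] conjI tautological_consequence[of "[\<phi>]"]) auto

lemma derives_modus_ponens:
  assumes "derives L \<Gamma> \<phi>" "derives L \<Gamma> (Imp \<phi> \<psi>)"
  shows "derives L \<Gamma> \<psi>"
proof -
  obtain xs ys where "set xs \<subseteq> \<Gamma>" "Imp (Conj xs) \<phi> \<in> L"
    and "set ys \<subseteq> \<Gamma>" "Imp (Conj ys) (Imp \<phi> \<psi>) \<in> L"
    using assms unfolding derives_def by blast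
  moreover from this have "Imp (Conj (xs @ ys)) \<psi> \<in> L"
    by (intro tautological_consequence[of "[Imp (Conj xs) \<phi>, Imp (Conj ys) (Imp \<phi> \<psi>)]"]) auto
  ultimately show ?thesis unfolding derives_def by (metis Un_least set_append)
qed

lemma derives_tautological:
  assumes "\<forall>\<chi>\<in>set \<chi>s. derives L \<Gamma> \<chi>"
    and "\<And>v m. \<forall>\<chi>\<in>set \<chi>s. bool_true v m \<chi> \<Longrightarrow> bool_true v m \<psi>"
  shows "derives L \<Gamma> \<psi>"
  using assms
proof (induction \<chi>s arbitrary: \<psi>)
  case Nil
  then show ?case by (auto intro: derives_logic tautology_in)
next
  case (Cons \<chi> \<chi>s)
  have "derives L \<Gamma> (Imp \<chi> \<psi>)"
    by (rule Cons.IH) (use Cons.prems in auto)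
  with Cons.prems(1) show ?case by (intro derives_modus_ponens[of \<Gamma> \<chi> \<psi>]) auto
qed

lemma deduction:
  assumes "derives L (insert \<phi> \<Gamma>) \<psi>"
  shows "derives L \<Gamma> (Imp \<phi> \<psi>)"
proof -
  obtain xs where xs: "set xs \<subseteq> insert \<phi> \<Gamma>" "Imp (Conj xs) \<psi> \<in> L"
    using assms unfolding derives_def by blast
  let ?ys = "filter (\<lambda>\<chi>. \<chi> \<noteq> \<phi>) xs"
  have "Imp (Conj ?ys) (Imp \<phi> \<psi>) \<in> L"
    by (rule tautological_consequence[of "[Imp (Conj xs) \<psi>]"]) (use xs in auto)
  with xs show ?thesis unfolding derives_def by (intro exI[of _ ?ys]) auto
qed

lemma derives_singleton: "derives L {\<phi>} \<psi> \<longleftrightarrow> Imp \<phi> \<psi> \<in> L"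
proof
  assume "derives L {\<phi>} \<psi>"
  then obtain xs where "set xs \<subseteq> {\<phi>}" "Imp (Conj xs) \<psi> \<in> L"
    unfolding derives_def by blast
  then show "Imp \<phi> \<psi> \<in> L"
    by (intro tautological_consequence[of "[Imp (Conj xs) \<psi>]"]) auto
next
  assume "Imp \<phi> \<psi> \<in> L"
  then show "derives L {\<phi>} \<psi>"
    by (intro derives_modus_ponens[OF derives_member derives_logic, of \<phi>]) auto
qed

section \<open>Maximal consistent sets and compactness\<close>

lemma lindenbaum:
  assumes "consistent L \<Gamma>"
  shows "\<exists>w\<in>canon_worlds L. \<Gamma> \<subseteq> w"
proof -
  let ?A = "{\<Delta>. consistent L \<Delta> \<and> \<Gamma> \<subseteq> \<Delta>}"
  have "\<exists>M\<in>?A. \<forall>X\<in>?A. M \<subseteq> X \<longrightarrow> X = M"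
  proof (rule subset_Zorn_nonempty)
    show "?A \<noteq> {}" using assms by auto
  next
    fix C assume C: "C \<noteq> {}" "subset.chain ?A C"
    have "consistent L (\<Union>C)"
      unfolding consistent_def
    proof
      assume "\<exists>\<phi>s. set \<phi>s \<subseteq> \<Union>C \<and> Imp (Conj \<phi>s) Bot \<in> L"
      then obtain \<phi>s where \<phi>s: "set \<phi>s \<subseteq> \<Union>C" "Imp (Conj \<phi>s) Bot \<in> L" by blast
      obtain \<Delta> where "\<Delta> \<in> C" "set \<phi>s \<subseteq> \<Delta>"
        using finite_subset_Union_chain[OF finite_set \<phi>s(1) C] by blast
      moreover have "consistent L \<Delta>"
        using C(2) \<open>\<Delta> \<in> C\<close> by (auto simp: subset.chain_def)
      ultimately show False using \<phi>s(2) by (auto simp: consistent_def)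
    qed
    moreover have "\<Gamma> \<subseteq> \<Union>C" using C by (fastforce simp: subset.chain_def)
    ultimately show "\<Union>C \<in> ?A" by simp
  qed
  then obtain M where M: "M \<in> ?A" "\<forall>X\<in>?A. M \<subseteq> X \<longrightarrow> X = M" ..
  then have "X = M" if "consistent L X" "M \<subseteq> X" for X
    using that by auto
  with M(1) show ?thesis by (auto simp: canon_worlds_def)
qed

lemma world_derives_Bot: "w \<in> canon_worlds L \<Longrightarrow> \<not> derives L w Bot"
  by (simp add: canon_worlds_def consistent_iff_derives)

lemma world_maximal:
  assumes "w \<in> canon_worlds L" "\<phi> \<notin> w"
  shows "derives L w (neg \<phi>)"
proof -
  have "\<not> consistent L (insert \<phi> w)"
    using assms unfolding canon_worlds_def by blast
  then have "derives L w (Imp \<phi> Bot)"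
    by (intro deduction) (simp add: consistent_iff_derives)
  then show ?thesis by (intro derives_tautological[of "[Imp \<phi> Bot]"]) auto
qed

lemma world_closed:
  assumes "w \<in> canon_worlds L" "derives L w \<phi>"
  shows "\<phi> \<in> w"
proof (rule ccontr)
  assume "\<phi> \<notin> w"
  with assms have "derives L w Bot"
    by (intro derives_tautological[of "[\<phi>, neg \<phi>]"]) (auto intro: world_maximal)
  with assms(1) show False by (simp add: world_derives_Bot)
qed

lemma world_neg:
  assumes w: "w \<in> canon_worlds L"
  shows "neg \<phi> \<in> w \<longleftrightarrow> \<phi> \<notin> w"
proof
  assume "neg \<phi> \<in> w"
  show "\<phi> \<notin> w"
  proof
    assume "\<phi> \<in> w"
    with \<open>neg \<phi> \<in> w\<close> have "derives L w Bot"
      by (intro derives_tautological[of "[\<phi>, neg \<phi>]"]) (auto intro: derives_member)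
    with w show False by (simp add: world_derives_Bot)
  qed
next
  assume "\<phi> \<notin> w"
  with w show "neg \<phi> \<in> w" by (intro world_closed world_maximal)
qed

lemma world_tautological:
  assumes "w \<in> canon_worlds L" "set \<chi>s \<subseteq> w"
    and "\<And>v m. \<forall>\<chi>\<in>set \<chi>s. bool_true v m \<chi> \<Longrightarrow> bool_true v m \<psi>"
  shows "\<psi> \<in> w"
  using assms by (intro world_closed derives_tautological[of \<chi>s]) (auto intro: derives_member)

lemma world_Imp:
  assumes "w \<in> canon_worlds L" "Imp \<phi> \<psi> \<in> L" "\<phi> \<in> w"
  shows "\<psi> \<in> w"
  using assms
  by (intro world_closed[of w \<psi>] derives_modus_ponens[OF derives_member derives_logic, of \<phi>])

lemma world_Top: "w \<in> canon_worlds L \<Longrightarrow> Top \<in> w"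
  by (rule world_tautological[of w "[]"]) auto

lemma world_Bot: "w \<in> canon_worlds L \<Longrightarrow> Bot \<notin> w"
  using world_neg[of w Bot] by (simp add: world_Top)

lemma world_And:
  assumes "w \<in> canon_worlds L"
  shows "And \<phi> \<psi> \<in> w \<longleftrightarrow> \<phi> \<in> w \<and> \<psi> \<in> w"
proof
  assume "And \<phi> \<psi> \<in> w"
  then show "\<phi> \<in> w \<and> \<psi> \<in> w"
    by (intro conjI; intro world_tautological[OF assms, of "[And \<phi> \<psi>]"]) auto
next
  assume "\<phi> \<in> w \<and> \<psi> \<in> w"
  then show "And \<phi> \<psi> \<in> w"
    by (intro world_tautological[OF assms, of "[\<phi>, \<psi>]"]) auto
qed

lemma world_Or:
  assumes "w \<in> canon_worlds L"
  shows "Or \<phi> \<psi> \<in> w \<longleftrightarrow> \<phi> \<in> w \<or> \<psi> \<in> w"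
  using world_And[OF assms, of "neg \<phi>" "neg \<psi>"] world_neg[OF assms, of "Or \<phi> \<psi>"]
    world_neg[OF assms, of \<phi>] world_neg[OF assms, of \<psi>]
  by auto

lemma ext_Top: "ext L Top = canon_worlds L"
  by (auto simp: ext_def ext_set_def world_Top)

lemma ext_Bot: "ext L Bot = {}"
  by (auto simp: ext_def ext_set_def world_Bot)

lemma ext_And: "ext L (And \<phi> \<psi>) = ext L \<phi> \<inter> ext L \<psi>"
  by (auto simp: ext_def ext_set_def world_And)

lemma ext_Or: "ext L (Or \<phi> \<psi>) = ext L \<phi> \<union> ext L \<psi>"
  by (auto simp: ext_def ext_set_def world_Or)

lemma ext_neg: "ext L (neg \<phi>) = canon_worlds L - ext L \<phi>"
  by (auto simp: ext_def ext_set_def world_neg)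

text \<open>The two ways in which \<open>\<Gamma>\<close> can entail \<open>\<phi>\<close> agree: if no finite part of \<open>\<Gamma>\<close> derives \<open>\<phi>\<close>, then
  \<open>\<Gamma>\<close> together with \<open>neg \<phi>\<close> extends to a world. Inclusions between closed sets and truth sets, which
  define the canonical operators, thereby become derivability.\<close>

lemma compactness: "ext_set L \<Gamma> \<subseteq> ext L \<phi> \<longleftrightarrow> derives L \<Gamma> \<phi>"
proof
  assume sub: "ext_set L \<Gamma> \<subseteq> ext L \<phi>"
  show "derives L \<Gamma> \<phi>"
  proof (rule ccontr)
    assume not: "\<not> derives L \<Gamma> \<phi>"
    have "consistent L (insert (neg \<phi>) \<Gamma>)"
      unfolding consistent_iff_derives
    proof
      assume "derives L (insert (neg \<phi>) \<Gamma>) Bot"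
      then have "derives L \<Gamma> (Imp (neg \<phi>) Bot)" by (rule deduction)
      then have "derives L \<Gamma> \<phi>" by (intro derives_tautological[of "[Imp (neg \<phi>) Bot]"]) auto
      with not show False ..
    qed
    then obtain w where "w \<in> canon_worlds L" "insert (neg \<phi>) \<Gamma> \<subseteq> w"
      using lindenbaum by blast
    with sub show False by (auto simp: ext_def ext_set_def world_neg)
  qed
next
  assume "derives L \<Gamma> \<phi>"
  then show "ext_set L \<Gamma> \<subseteq> ext L \<phi>"
    by (auto simp: ext_def ext_set_def intro: world_closed derives_mono)
qed

lemma compactness_disjoint:
  "ext L \<phi> \<subseteq> canon_worlds L - ext_set L \<Gamma> \<longleftrightarrow> derives L \<Gamma> (neg \<phi>)"
  unfolding compactness[symmetric] ext_neg by (auto simp: ext_def ext_set_def)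

section \<open>The relation induced by a fragment\<close>

definition fragment_rel :: "fm set \<Rightarrow> (fm set \<times> fm set) set" where
  "fragment_rel S = {(w, v). w \<in> canon_worlds L \<and> v \<in> canon_worlds L \<and> w \<inter> S \<subseteq> v}"

end

text \<open>Besides the positive formulas, their negations form such a set. Stating results for all
  fragments is what makes the two directions of a bisimulation a single proof.\<close>

definition fragment :: "fm set \<Rightarrow> bool" where
  "fragment S \<longleftrightarrow> Bot \<in> S \<and> Top \<in> S \<and>
     (\<forall>\<phi>\<in>S. \<forall>\<psi>\<in>S. And \<phi> \<psi> \<in> S \<and> Or \<phi> \<psi> \<in> S) \<and> (\<forall>\<phi>\<in>S. Dia \<phi> \<in> S \<and> Box \<phi> \<in> S)"

lemma mem_neg_image: "\<phi> \<in> neg ` S \<longleftrightarrow> neg \<phi> \<in> S"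
  by (metis image_iff neg_neg)

lemma fragment_neg: "fragment S \<Longrightarrow> fragment (neg ` S)"
  by (simp add: fragment_def mem_neg_image Ball_def)

lemma fragment_Conj: "fragment S \<Longrightarrow> set \<phi>s \<subseteq> S \<Longrightarrow> Conj \<phi>s \<in> S"
  by (induction \<phi>s) (auto simp: Conj_def fragment_def)

context modal
begin

text \<open>Contraposition: \<open>v\<close> contains all \<open>S\<close>-formulas of \<open>w\<close> iff \<open>w\<close> contains all negated
  \<open>S\<close>-formulas of \<open>v\<close>.\<close>

lemma fragment_rel_neg: "fragment_rel (neg ` S) = (fragment_rel S)\<inverse>"
  by (force simp: fragment_rel_def world_neg)

definition fragment_consequences :: "fm set \<Rightarrow> fm set \<Rightarrow> fm set" where
  "fragment_consequences S \<Gamma> = {\<alpha>\<in>S. derives L \<Gamma> \<alpha>}"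

lemma derives_Conj: "(\<forall>\<alpha>\<in>set \<alpha>s. derives L \<Gamma> \<alpha>) \<Longrightarrow> derives L \<Gamma> (Conj \<alpha>s)"
  by (rule derives_tautological[of \<alpha>s]) auto

text \<open>Finitely many consequences of \<open>\<Gamma>\<close> in \<open>S\<close> suffice to derive \<open>\<psi>\<close>, and their conjunction is a single
  formula of \<open>S\<close>, to which a modality can then be applied.\<close>

lemma derives_fragment_interpolant:
  assumes "fragment S" "derives L (fragment_consequences S \<Gamma>) \<psi>"
  obtains \<alpha> where "\<alpha> \<in> S" "derives L \<Gamma> \<alpha>" "Imp \<alpha> \<psi> \<in> L"
proof -
  obtain \<alpha>s where "set \<alpha>s \<subseteq> fragment_consequences S \<Gamma>" "Imp (Conj \<alpha>s) \<psi> \<in> L"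
    using assms(2) unfolding derives_def by blast
  then show thesis
    using fragment_Conj[OF assms(1), of \<alpha>s] derives_Conj[of \<alpha>s \<Gamma>]
    by (intro that[of "Conj \<alpha>s"]) (auto simp: fragment_consequences_def)
qed

text \<open>For the nontrivial inclusion, a predecessor of \<open>v\<close> in the closed set of \<open>\<Gamma>\<close> is a world containing
  \<open>\<Gamma>\<close> and the set \<open>N\<close> of all negated \<open>S\<close>-formulas true in \<open>v\<close>. If \<open>\<Gamma> \<union> N\<close> were
  inconsistent, then \<open>\<Gamma>\<close> would derive the negation of a conjunction of members of \<open>N\<close>. That negation
  is an \<open>S\<close>-consequence of \<open>\<Gamma>\<close>, hence true in \<open>v\<close>, although \<open>v\<close> contains \<open>N\<close>.\<close>

lemma fragment_rel_image_ext_set: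
  assumes S: "fragment S"
  shows "fragment_rel S `` ext_set L \<Gamma> = ext_set L (fragment_consequences S \<Gamma>)"
proof (intro equalityI subsetI)
  fix v assume "v \<in> fragment_rel S `` ext_set L \<Gamma>"
  then obtain w where w: "w \<in> canon_worlds L" "\<Gamma> \<subseteq> w" "w \<inter> S \<subseteq> v" and v: "v \<in> canon_worlds L"
    by (auto simp: fragment_rel_def ext_set_def)
  have "fragment_consequences S \<Gamma> \<subseteq> w \<inter> S"
    using world_closed[OF w(1)] derives_mono[OF _ w(2)] by (auto simp: fragment_consequences_def)
  with w(3) v show "v \<in> ext_set L (fragment_consequences S \<Gamma>)" by (auto simp: ext_set_def)
next
  fix v assume "v \<in> ext_set L (fragment_consequences S \<Gamma>)"
  then have v: "v \<in> canon_worlds L" "fragment_consequences S \<Gamma> \<subseteq> v"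
    by (auto simp: ext_set_def)
  let ?N = "{\<beta>. \<beta> \<in> neg ` S \<and> \<beta> \<in> v}"
  have "consistent L (\<Gamma> \<union> ?N)"
    unfolding consistent_iff_derives
  proof
    assume "derives L (\<Gamma> \<union> ?N) Bot"
    then obtain xs where xs: "set xs \<subseteq> \<Gamma> \<union> ?N" "Imp (Conj xs) Bot \<in> L"
      unfolding derives_def by blast
    let ?gs = "filter (\<lambda>\<chi>. \<chi> \<in> \<Gamma>) xs" and ?ns = "filter (\<lambda>\<chi>. \<chi> \<notin> \<Gamma>) xs"
    have ns: "set ?ns \<subseteq> ?N" using xs(1) by auto
    have "Imp (Conj ?gs) (neg (Conj ?ns)) \<in> L"
      by (rule tautological_consequence[of "[Imp (Conj xs) Bot]"]) (use xs(2) in auto)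
    then have "derives L \<Gamma> (neg (Conj ?ns))" unfolding derives_def by (intro exI[of _ ?gs]) auto
    moreover have "Conj ?ns \<in> neg ` S"
      using ns by (intro fragment_Conj[OF fragment_neg[OF S]]) blast
    then have "neg (Conj ?ns) \<in> S" by (simp only: mem_neg_image)
    ultimately have "neg (Conj ?ns) \<in> v"
      using v(2) by (auto simp: fragment_consequences_def)
    moreover have "Conj ?ns \<in> v"
      by (rule world_tautological[OF v(1), of ?ns]) (use ns in auto)
    ultimately show False using v(1) by (simp add: world_neg)
  qed
  then obtain w where w: "w \<in> canon_worlds L" "\<Gamma> \<union> ?N \<subseteq> w"
    using lindenbaum by blast
  have "\<phi> \<in> v" if "\<phi> \<in> w" "\<phi> \<in> S" for \<phi>
  proof (rule ccontr)
    assume "\<phi> \<notin> v"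
    then have "neg \<phi> \<in> ?N" using that(2) v(1) by (simp add: world_neg)
    then have "neg \<phi> \<in> w" using w(2) by blast
    with that(1) w(1) show False by (simp add: world_neg)
  qed
  then have "(w, v) \<in> fragment_rel S"
    using w(1) v(1) by (auto simp: fragment_rel_def)
  moreover have "w \<in> ext_set L \<Gamma>" using w by (simp add: ext_set_def)
  ultimately show "v \<in> fragment_rel S `` ext_set L \<Gamma>" by blast
qed

text \<open>Closure under the relation says that the \<open>S\<close>-consequences of \<open>\<phi>\<close> entail \<open>\<phi>\<close>; by compactness a
  single one of them already does.\<close>

lemma definable_in_fragment:
  assumes S: "fragment S" and closed: "fragment_rel S `` ext L \<phi> \<subseteq> ext L \<phi>"
  obtains \<alpha> where "\<alpha> \<in> S" "Iff \<phi> \<alpha> \<in> L"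
proof -
  have "derives L (fragment_consequences S {\<phi>}) \<phi>"
    using closed fragment_rel_image_ext_set[OF S, of "{\<phi>}"]
    by (simp add: ext_def flip: compactness)
  then obtain \<alpha> where "\<alpha> \<in> S" "Imp \<phi> \<alpha> \<in> L" "Imp \<alpha> \<phi> \<in> L"
    by (rule derives_fragment_interpolant[OF S]) (auto simp: derives_singleton)
  then show thesis
    by (intro that[of \<alpha>] tautological_consequence[of "[Imp \<phi> \<alpha>, Imp \<alpha> \<phi>]"]) auto
qed

end

section \<open>The two canonical operators\<close>

locale monotone_modal = modal +
  assumes monotone_L: "monotone_logic L"
begin

text \<open>Substitute \<open>\<phi>\<close>, \<open>\<psi>\<close> into the monotonicity axiom; \<open>Or \<phi> \<psi>\<close> is then equivalent to \<open>\<psi>\<close>, and the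
  congruence rule for the diamond applies.\<close>

lemma Dia_monotone:
  assumes "Imp \<phi> \<psi> \<in> L"
  shows "Imp (Dia \<phi>) (Dia \<psi>) \<in> L"
proof -
  let ?s = "\<lambda>x::var. if x = 0 then \<phi> else \<psi>"
  have "Imp (Dia (Var 0)) (Dia (Or (Var 0) (Var 1))) \<in> L"
    using monotone_L unfolding monotone_logic_def by (metis zero_neq_one)
  from subst_in[OF this, of ?s]
  have 1: "Imp (Dia \<phi>) (Dia (Or \<phi> \<psi>)) \<in> L"
    by (simp add: Imp_def subst_neg)
  have "Iff (Or \<phi> \<psi>) \<psi> \<in> L"
    by (rule tautological_consequence[of "[Imp \<phi> \<psi>]"]) (use assms in auto)
  then have "Iff (Dia (Or \<phi> \<psi>)) (Dia \<psi>) \<in> L" by (rule Dia_congruence)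
  with 1 show ?thesis
    by (intro tautological_consequence[of
          "[Imp (Dia \<phi>) (Dia (Or \<phi> \<psi>)), Iff (Dia (Or \<phi> \<psi>)) (Dia \<psi>)]"]) auto
qed

lemma world_Dia_mono:
  "w \<in> canon_worlds L \<Longrightarrow> Imp \<phi> \<psi> \<in> L \<Longrightarrow> Dia \<phi> \<in> w \<Longrightarrow> Dia \<psi> \<in> w"
  by (rule world_Imp[OF _ Dia_monotone])

lemma mem_dia_sigma:
  "w \<in> dia_sigma L X \<longleftrightarrow> w \<in> canon_worlds L \<and>
     (\<exists>\<Gamma>. ext_set L \<Gamma> \<subseteq> X \<and> (\<forall>\<phi>. derives L \<Gamma> \<phi> \<longrightarrow> Dia \<phi> \<in> w))"
proof -
  (* The inner intersection is over a nonempty family, so its members are worlds. *)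
  have "derives L \<Gamma> Top" for \<Gamma>
    using derives_logic[OF tautology_in[of Top]] by auto
  then have "w \<in> (\<Inter>\<phi>\<in>{\<phi>. derives L \<Gamma> \<phi>}. ext L (Dia \<phi>)) \<longleftrightarrow>
      w \<in> canon_worlds L \<and> (\<forall>\<phi>. derives L \<Gamma> \<phi> \<longrightarrow> Dia \<phi> \<in> w)" for \<Gamma>
    unfolding ext_def ext_set_def by blast
  then show ?thesis
    unfolding dia_sigma_def compactness by blast
qed

lemma mem_dia_pi:
  assumes "X \<subseteq> canon_worlds L"
  shows "w \<in> dia_pi L X \<longleftrightarrow> w \<in> canon_worlds L \<and>
     (\<forall>\<Gamma>. X \<inter> ext_set L \<Gamma> = {} \<longrightarrow> (\<exists>\<phi>. derives L \<Gamma> (neg \<phi>) \<and> Dia \<phi> \<in> w))"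
proof -
  (* The outer intersection is over a nonempty family, so its members are worlds. *)
  have "X \<subseteq> canon_worlds L - ext_set L {Bot}"
    using assms ext_Bot by (simp add: ext_def)
  moreover have "X \<subseteq> canon_worlds L - ext_set L \<Gamma> \<longleftrightarrow> X \<inter> ext_set L \<Gamma> = {}" for \<Gamma>
    using assms by auto
  ultimately show ?thesis
    unfolding dia_pi_def compactness_disjoint by (auto simp: ext_def ext_set_def) blast+
qed

text \<open>The common features of \<open>dia_sigma\<close> and \<open>dia_pi\<close> from which the theorem follows: they yield a
  monotone frame, the truth lemma, and the zig condition for the relation of every fragment. The zag
  condition is the zig condition for the fragment of negations.\<close>

definition canonical_dia :: "(fm set set \<Rightarrow> fm set set) \<Rightarrow> bool" where
  "canonical_dia D \<longleftrightarrow>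
     (\<forall>X Y. X \<subseteq> Y \<longrightarrow> Y \<subseteq> canon_worlds L \<longrightarrow> D X \<subseteq> D Y) \<and>
     (\<forall>\<phi>. D (ext L \<phi>) = ext L (Dia \<phi>)) \<and>
     (\<forall>S X. fragment S \<longrightarrow> X \<subseteq> canon_worlds L \<longrightarrow>
        fragment_rel S `` D X \<subseteq> D (fragment_rel S `` X))"

text \<open>Zig condition: if \<open>\<Gamma>\<close> witnesses that \<open>w\<close> is in \<open>dia_sigma L X\<close>, then the \<open>S\<close>-consequences of \<open>\<Gamma>\<close>
  are a witness for \<open>v\<close>: whatever they derive is already derived by one \<open>\<alpha>\<close> in \<open>S\<close>, and \<open>Dia \<alpha>\<close>
  passes from \<open>w\<close> to \<open>v\<close>.\<close>

lemma canonical_dia_sigma: "canonical_dia (dia_sigma L)"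
  unfolding canonical_dia_def
proof (intro conjI allI impI)
  fix X Y :: "fm set set" assume "X \<subseteq> Y"
  then show "dia_sigma L X \<subseteq> dia_sigma L Y" by (auto simp: mem_dia_sigma) (blast intro: order_trans)
next
  fix \<phi>
  have "w \<in> dia_sigma L (ext L \<phi>) \<longleftrightarrow> w \<in> canon_worlds L \<and> Dia \<phi> \<in> w" for w
  proof -
    have "\<exists>\<Gamma>. derives L \<Gamma> \<phi> \<and> (\<forall>\<psi>. derives L \<Gamma> \<psi> \<longrightarrow> Dia \<psi> \<in> w)"
      if "w \<in> canon_worlds L" "Dia \<phi> \<in> w"
      by (rule exI[of _ "{\<phi>}"]) (use that derives_member[of \<phi> "{\<phi>}"] in \<open>auto simp: derives_singleton intro: world_Dia_mono\<close>)
    then show ?thesis by (auto simp: mem_dia_sigma compactness)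
  qed
  then show "dia_sigma L (ext L \<phi>) = ext L (Dia \<phi>)" by (auto simp: ext_def ext_set_def)
next
  fix S X assume S: "fragment S"
  show "fragment_rel S `` dia_sigma L X \<subseteq> dia_sigma L (fragment_rel S `` X)"
  proof
    fix v assume "v \<in> fragment_rel S `` dia_sigma L X"
    then obtain w \<Gamma> where wv: "w \<in> canon_worlds L" "v \<in> canon_worlds L" "w \<inter> S \<subseteq> v"
      and \<Gamma>: "ext_set L \<Gamma> \<subseteq> X" "\<forall>\<phi>. derives L \<Gamma> \<phi> \<longrightarrow> Dia \<phi> \<in> w"
      by (auto simp: fragment_rel_def mem_dia_sigma)
    have "Dia \<psi> \<in> v" if \<psi>: "derives L (fragment_consequences S \<Gamma>) \<psi>" for \<psi>
    proof -
      from \<psi> obtain \<alpha> where \<alpha>: "\<alpha> \<in> S" "derives L \<Gamma> \<alpha>" "Imp \<alpha> \<psi> \<in> L"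
        by (rule derives_fragment_interpolant[OF S])
      then have "Dia \<alpha> \<in> v" using S \<Gamma>(2) wv by (auto simp: fragment_def)
      with \<alpha>(3) wv(2) show ?thesis by (blast intro: world_Dia_mono)
    qed
    moreover have "ext_set L (fragment_consequences S \<Gamma>) \<subseteq> fragment_rel S `` X"
      using \<Gamma>(1) fragment_rel_image_ext_set[OF S, of \<Gamma>] by blast
    ultimately show "v \<in> dia_sigma L (fragment_rel S `` X)"
      using wv(2) by (auto simp: mem_dia_sigma)
  qed
qed

text \<open>Zig condition: a closed set disjoint from the image of \<open>X\<close> has a preimage disjoint from \<open>X\<close>, and that
  preimage is the closed set of the consequences in the negated fragment. The diamond formula of \<open>w\<close>
  separating \<open>X\<close> from this preimage can be weakened to some \<open>Dia (neg \<beta>)\<close> with \<open>neg \<beta>\<close> in \<open>S\<close>, which passes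
  from \<open>w\<close> to \<open>v\<close>.\<close>

lemma canonical_dia_pi: "canonical_dia (dia_pi L)"
  unfolding canonical_dia_def
proof (intro conjI allI impI)
  fix X Y assume XY: "X \<subseteq> Y" "Y \<subseteq> canon_worlds L"
  then have "X \<subseteq> canon_worlds L" by blast
  with XY show "dia_pi L X \<subseteq> dia_pi L Y" by (auto simp: mem_dia_pi) blast
next
  fix \<phi>
  have sub: "ext L \<phi> \<subseteq> canon_worlds L" by (auto simp: ext_def ext_set_def)
  have disjoint: "ext L \<phi> \<inter> ext_set L \<Gamma> = {} \<longleftrightarrow> derives L \<Gamma> (neg \<phi>)" for \<Gamma>
    using sub compactness_disjoint[of \<phi> \<Gamma>] by blast
  have "w \<in> dia_pi L (ext L \<phi>) \<longleftrightarrow> w \<in> canon_worlds L \<and> Dia \<phi> \<in> w" for w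
  proof
    assume "w \<in> dia_pi L (ext L \<phi>)"
    then obtain \<psi> where w: "w \<in> canon_worlds L"
      and \<psi>: "derives L {neg \<phi>} (neg \<psi>)" "Dia \<psi> \<in> w"
      using derives_member[of "neg \<phi>" "{neg \<phi>}"] by (auto simp: mem_dia_pi[OF sub] disjoint)
    have "Imp \<psi> \<phi> \<in> L"
      by (rule tautological_consequence[of "[Imp (neg \<phi>) (neg \<psi>)]"])
        (use \<psi>(1) in \<open>auto simp: derives_singleton\<close>)
    with w \<psi>(2) show "w \<in> canon_worlds L \<and> Dia \<phi> \<in> w" by (blast intro: world_Dia_mono)
  next
    assume "w \<in> canon_worlds L \<and> Dia \<phi> \<in> w"
    then show "w \<in> dia_pi L (ext L \<phi>)" by (auto simp: mem_dia_pi[OF sub] disjoint)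
  qed
  then show "dia_pi L (ext L \<phi>) = ext L (Dia \<phi>)" by (auto simp: ext_def ext_set_def)
next
  fix S X assume S: "fragment S" and X: "X \<subseteq> canon_worlds L"
  have ZX: "fragment_rel S `` X \<subseteq> canon_worlds L" by (auto simp: fragment_rel_def)
  show "fragment_rel S `` dia_pi L X \<subseteq> dia_pi L (fragment_rel S `` X)"
  proof
    fix v assume "v \<in> fragment_rel S `` dia_pi L X"
    then obtain w where wv: "w \<in> canon_worlds L" "v \<in> canon_worlds L" "w \<inter> S \<subseteq> v"
      and w: "\<And>\<Gamma>. X \<inter> ext_set L \<Gamma> = {} \<Longrightarrow> \<exists>\<phi>. derives L \<Gamma> (neg \<phi>) \<and> Dia \<phi> \<in> w"
      by (auto simp: fragment_rel_def mem_dia_pi[OF X])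
    have "\<exists>\<phi>. derives L \<Gamma> (neg \<phi>) \<and> Dia \<phi> \<in> v" if \<Gamma>: "fragment_rel S `` X \<inter> ext_set L \<Gamma> = {}" for \<Gamma>
    proof -
      have "(fragment_rel S)\<inverse> `` ext_set L \<Gamma> = ext_set L (fragment_consequences (neg ` S) \<Gamma>)"
        using fragment_rel_image_ext_set[OF fragment_neg[OF S]] by (simp add: fragment_rel_neg)
      with \<Gamma> have "X \<inter> ext_set L (fragment_consequences (neg ` S) \<Gamma>) = {}" by blast
      from w[OF this] obtain \<phi> where
        \<phi>: "derives L (fragment_consequences (neg ` S) \<Gamma>) (neg \<phi>)" "Dia \<phi> \<in> w" by blast
      obtain \<beta> where \<beta>: "\<beta> \<in> neg ` S" "derives L \<Gamma> \<beta>" "Imp \<beta> (neg \<phi>) \<in> L"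
        using derives_fragment_interpolant[OF fragment_neg[OF S] \<phi>(1)] .
      have "Imp \<phi> (neg \<beta>) \<in> L"
        by (rule tautological_consequence[of "[Imp \<beta> (neg \<phi>)]"]) (use \<beta>(3) in auto)
      then have "Dia (neg \<beta>) \<in> w" using wv(1) \<phi>(2) by (blast intro: world_Dia_mono)
      moreover have "Dia (neg \<beta>) \<in> S" using S \<beta>(1) by (auto simp: fragment_def)
      ultimately show ?thesis using \<beta>(2) wv(3) by (intro exI[of _ "neg \<beta>"]) auto
    qed
    then show "v \<in> dia_pi L (fragment_rel S `` X)" using wv(2) by (simp add: mem_dia_pi[OF ZX])
  qed
qed

end

section \<open>Semantics in neighborhood frames\<close>

lemma sem_subset:
  assumes "is_nframe F" "\<And>p. \<theta> p \<subseteq> worlds F"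
  shows "sem F \<theta> \<phi> \<subseteq> worlds F"
proof (induction \<phi>)
  case (Lit l)
  then show ?case using assms(2) by (cases l) auto
qed (use assms(1) in \<open>auto simp: is_nframe_def box_def\<close>)

lemma sem_neg:
  assumes F: "is_nframe F" and \<theta>: "\<And>p. \<theta> p \<subseteq> worlds F"
  shows "sem F \<theta> (neg \<phi>) = worlds F - sem F \<theta> \<phi>"
proof (induction \<phi>)
  case (Lit l)
  then show ?case using \<theta> by (cases l) (auto simp: double_diff)
next
  case (Dia \<phi>)
  then show ?case using sem_subset[of F \<theta> \<phi>, OF F \<theta>] by (simp add: box_def double_diff)
next
  case (Box \<phi>)
  have "dia F (worlds F - sem F \<theta> \<phi>) \<subseteq> worlds F" using F by (simp add: is_nframe_def)
  with Box show ?case by (simp add: box_def double_diff)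
qed auto

lemma sem_subst:
  assumes F: "is_nframe F" and \<theta>: "\<And>p. \<theta> p \<subseteq> worlds F"
  shows "sem F \<theta> (subst s \<phi>) = sem F (\<lambda>p. sem F \<theta> (s p)) \<phi>"
proof (induction \<phi>)
  case (Lit l)
  then show ?case by (cases l) (auto simp: sem_neg[OF F \<theta>])
qed auto

lemma sem_cong: "(\<And>p. p \<in> vars \<phi> \<Longrightarrow> \<theta> p = \<theta>' p) \<Longrightarrow> sem F \<theta> \<phi> = sem F \<theta>' \<phi>"
proof (induction \<phi>)
  case (Lit l)
  then show ?case by (cases l) (auto simp: vars_def)
qed (auto simp: vars_def)

lemma sem_Imp_valid:
  assumes "logic_frame L F" "Imp \<phi> \<psi> \<in> L" and \<theta>: "\<And>p. \<theta> p \<subseteq> worlds F"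
  shows "sem F \<theta> \<phi> \<subseteq> sem F \<theta> \<psi>"
proof -
  have F: "is_nframe F" and "sem F \<theta> (Imp \<phi> \<psi>) = worlds F"
    using assms by (auto simp: logic_frame_def valid_def)
  then show ?thesis
    using sem_subset[of F \<theta> \<phi>, OF F \<theta>] by (auto simp: Imp_def sem_neg[OF F \<theta>])
qed

text \<open>Taking preimages under \<open>f\<close> commutes with the Boolean operations and, by hypothesis, with the
  diamond. The two projections of a bisimulation product are the intended \<open>f\<close>.\<close>

lemma sem_pullback:
  assumes F': "f ` worlds F' \<subseteq> worlds F" and F: "is_nframe F" and \<theta>: "\<And>p. \<theta> p \<subseteq> worlds F"
    and dia: "\<And>X. X \<subseteq> worlds F \<Longrightarrow> dia F' {z\<in>worlds F'. f z \<in> X} = {z\<in>worlds F'. f z \<in> dia F X}"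
  shows "sem F' (\<lambda>p. {z\<in>worlds F'. f z \<in> \<theta> p}) \<phi> = {z\<in>worlds F'. f z \<in> sem F \<theta> \<phi>}"
proof (induction \<phi>)
  case (Lit l)
  then show ?case using F' by (cases l) auto
next
  case (Dia \<phi>)
  then show ?case using dia[OF sem_subset[OF F \<theta>]] by simp
next
  case (Box \<phi>)
  have "worlds F' - {z\<in>worlds F'. f z \<in> sem F \<theta> \<phi>} = {z\<in>worlds F'. f z \<in> worlds F - sem F \<theta> \<phi>}"
    using F' by auto
  with Box dia[of "worlds F - sem F \<theta> \<phi>"] show ?case using F' by (auto simp: box_def)
qed (use F' in auto)

section \<open>Positivity from preservation under bisimulation products\<close>

definition positive_fragment :: "var list \<Rightarrow> var list \<Rightarrow> fm set" where
  "positive_fragment ps rs = {\<alpha>. vars \<alpha> \<subseteq> set (ps @ rs) \<and> positive_in ps \<alpha>}"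

lemma fragment_positive_fragment: "fragment (positive_fragment ps rs)"
  by (auto simp: fragment_def positive_fragment_def positive_in_def vars_def)

context monotone_modal
begin

lemma truth_lemma:
  assumes "worlds F = canon_worlds L" "canonical_dia (dia F)"
  shows "sem F (\<lambda>p. ext L (Var p)) \<phi> = ext L \<phi>"
proof (induction \<phi>)
  case (Lit l)
  then show ?case using assms(1) ext_neg[of "Var p" for p] by (cases l) auto
next
  case (Box \<phi>)
  have "ext L (Box \<phi>) = canon_worlds L - ext L (Dia (neg \<phi>))"
    using ext_neg[of "Dia (neg \<phi>)"] by simp
  with Box assms show ?case by (simp add: box_def canonical_dia_def flip: ext_neg)
qed (use assms in \<open>auto simp: ext_Top ext_Bot ext_And ext_Or canonical_dia_def\<close>)

text \<open>The zig condition for \<open>neg ` S\<close> is the zag condition for \<open>S\<close>, since negating the fragment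
  converts the relation. The relation contains the identity on worlds, so it is full.\<close>

lemma full_bisimulation_fragment_rel:
  assumes F: "is_nframe F" "worlds F = canon_worlds L" "canonical_dia (dia F)" and S: "fragment S"
  shows "full_bisimulation F F (fragment_rel S)"
proof -
  have "monotone_frame F" using F by (simp add: monotone_frame_def canonical_dia_def)
  moreover have "fragment_rel S `` dia F X \<subseteq> dia F (fragment_rel S `` X)"
    "(fragment_rel S)\<inverse> `` dia F X \<subseteq> dia F ((fragment_rel S)\<inverse> `` X)"
    if "X \<subseteq> canon_worlds L" for X
    using F(3) S fragment_neg[OF S] that fragment_rel_neg[of S]
    unfolding canonical_dia_def by metis+
  ultimately have "bisimulation F F (fragment_rel S)"
    by (auto simp: bisimulation_def F(2) fragment_rel_def)
  then show ?thesis by (fastforce simp: full_bisimulation_def F(2) fragment_rel_def)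
qed

text \<open>The two pullbacks \<open>\<theta>1\<close>, \<open>\<theta>2\<close> of the canonical valuation to the bisimulation product are compared
  through a valuation \<open>\<theta>\<close> under which the variables of \<open>\<phi>\<close> have their values in \<open>\<theta>1\<close>, and their
  substitutes under \<open>join_subst\<close> the values in \<open>\<theta>2\<close>. Validity of the monotonicity formula at \<open>\<theta>\<close>
  is then the claim.\<close>

lemma ext_closed_if_monotone_in:
  assumes F: "logic_frame L F" "worlds F = canon_worlds L" "canonical_dia (dia F)"
    and preserved: "preserved_under_bisimulation_products TYPE(fm set) L"
    and vars: "distinct (ps @ rs)" "vars \<phi> \<subseteq> set (ps @ rs)"
    and mono: "monotone_in L ps rs \<phi>"
  shows "fragment_rel (positive_fragment ps rs) `` ext L \<phi> \<subseteq> ext L \<phi>"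
proof -
  define Z where "Z = fragment_rel (positive_fragment ps rs)"
  have F': "is_nframe F" using F(1) by (simp add: logic_frame_def)
  have "full_bisimulation F F Z"
    unfolding Z_def using full_bisimulation_fragment_rel F' F(2,3) fragment_positive_fragment .
  then obtain P where P: "bisimulation_product F F Z P" "logic_frame L P"
    using preserved F(1) unfolding preserved_under_bisimulation_products_def by blast
  have wP: "worlds P = Z" and P': "is_nframe P"
    using P by (auto simp: bisimulation_product_def)
  have Z: "Z \<subseteq> worlds F \<times> worlds F" by (auto simp: Z_def fragment_rel_def F(2))
  define \<theta>1 \<theta>2 where "\<theta>1 = (\<lambda>p. {z\<in>Z. fst z \<in> ext L (Var p)})"
    and "\<theta>2 = (\<lambda>p. {z\<in>Z. snd z \<in> ext L (Var p)})"
  have sub: "ext L \<chi> \<subseteq> worlds F" for \<chi> by (auto simp: ext_def ext_set_def F(2))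
  have sem1: "sem P \<theta>1 \<chi> = {z\<in>Z. fst z \<in> ext L \<chi>}" for \<chi>
  proof -
    have "fst ` worlds P \<subseteq> worlds F" using Z by (auto simp: wP)
    moreover have "dia P {z\<in>worlds P. fst z \<in> X} = {z\<in>worlds P. fst z \<in> dia F X}"
      if "X \<subseteq> worlds F" for X
      using P(1) that by (simp add: bisimulation_product_def)
    ultimately show ?thesis
      using sem_pullback[of fst P F "\<lambda>p. ext L (Var p)" \<chi>, OF _ F' sub]
      by (simp add: \<theta>1_def wP truth_lemma[OF F(2,3)])
  qed
  have sem2: "sem P \<theta>2 \<chi> = {z\<in>Z. snd z \<in> ext L \<chi>}" for \<chi>
  proof -
    have "snd ` worlds P \<subseteq> worlds F" using Z by (auto simp: wP)
    moreover have "dia P {z\<in>worlds P. snd z \<in> X} = {z\<in>worlds P. snd z \<in> dia F X}"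
      if "X \<subseteq> worlds F" for X
      using P(1) that by (simp add: bisimulation_product_def)
    ultimately show ?thesis
      using sem_pullback[of snd P F "\<lambda>p. ext L (Var p)" \<chi>, OF _ F' sub]
      by (simp add: \<theta>2_def wP truth_lemma[OF F(2,3)])
  qed
  have mono_ps: "\<theta>1 x \<subseteq> \<theta>2 x" if "x \<in> set ps" for x
  proof -
    have "Var x \<in> positive_fragment ps rs"
      using that by (auto simp: positive_fragment_def positive_in_def vars_def)
    then show ?thesis
      by (auto simp: \<theta>1_def \<theta>2_def Z_def fragment_rel_def ext_def ext_set_def)
  qed
  have eq_rs: "\<theta>1 x = \<theta>2 x" if "x \<in> set rs" for x
  proof -
    have "Var x \<in> positive_fragment ps rs" "neg (Var x) \<in> positive_fragment ps rs"
      using that vars(1) by (auto simp: positive_fragment_def positive_in_def vars_def)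
    then have "Var x \<in> w \<longleftrightarrow> Var x \<in> v" if "(w, v) \<in> Z" for w v
      using that world_neg[of w "Var x"] world_neg[of v "Var x"]
      by (auto simp: Z_def fragment_rel_def simp del: neg.simps)
    then show ?thesis
      using Z by (auto simp: \<theta>1_def \<theta>2_def ext_def ext_set_def F(2))
  qed
  obtain qs where qs: "length qs = length ps" "distinct qs" "set qs \<inter> (set ps \<union> set rs) = {}"
    and Imp: "Imp \<phi> (subst (join_subst ps qs) \<phi>) \<in> L"
    using mono unfolding monotone_in_def by blast
  (* The fresh copy of p takes the larger value of p, so that p joined with its copy has
     the value that p has under the pullback along the second projection. *)
  define \<theta> where "\<theta> = (\<lambda>x. case map_of (zip qs ps) x of None \<Rightarrow> \<theta>1 x | Some p \<Rightarrow> \<theta>2 p)"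
  have \<theta>_sub: "\<theta> x \<subseteq> worlds P" for x
    by (auto simp: \<theta>_def \<theta>1_def \<theta>2_def wP split: option.splits)
  have \<theta>_old: "\<theta> x = \<theta>1 x" if "x \<in> set (ps @ rs)" for x
  proof -
    have "map_of (zip qs ps) x = None" using that qs by (auto simp: map_of_zip_is_None)
    then show ?thesis by (simp add: \<theta>_def)
  qed
  have join: "sem P \<theta> (join_subst ps qs x) = \<theta>2 x" if x: "x \<in> set (ps @ rs)" for x
  proof (cases "x \<in> set ps")
    case True
    then obtain i where i: "i < length ps" "x = ps ! i" by (auto simp: in_set_conv_nth)
    have "map_of (zip ps qs) x = Some (qs ! i)" "map_of (zip qs ps) (qs ! i) = Some x"
      using i qs vars(1) by (auto simp: map_of_zip_nth)
    then show ?thesis using mono_ps[OF True] \<theta>_old[OF x] by (auto simp: join_subst_def \<theta>_def)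
  next
    case False
    then have "map_of (zip ps qs) x = None" using qs(1) by (simp add: map_of_zip_is_None)
    then show ?thesis using False x eq_rs \<theta>_old[OF x] by (simp add: join_subst_def)
  qed
  have "sem P \<theta>1 \<phi> = sem P \<theta> \<phi>"
    by (rule sem_cong) (use vars(2) \<theta>_old in auto)
  also have "\<dots> \<subseteq> sem P \<theta> (subst (join_subst ps qs) \<phi>)"
    using sem_Imp_valid[OF P(2) Imp \<theta>_sub] .
  also have "\<dots> = sem P (\<lambda>x. sem P \<theta> (join_subst ps qs x)) \<phi>"
    using sem_subst[OF P' \<theta>_sub] .
  also have "\<dots> = sem P \<theta>2 \<phi>"
    by (rule sem_cong) (use vars(2) join in auto)
  finally show ?thesis unfolding sem1 sem2 Z_def[symmetric] by force
qed

end

theorem theorem5p5: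
  fixes L :: "fm set"
  assumes "monotone_logic L"
    and "sigma_canonical L \<or> pi_canonical L"
    and "preserved_under_bisimulation_products TYPE(fm set) L"
  shows "LPP L"
proof -
  interpret monotone_modal L
    using assms(1) by unfold_locales (auto simp: monotone_logic_def)
  obtain F where F: "logic_frame L F" "worlds F = canon_worlds L" "canonical_dia (dia F)"
    using assms(2) canonical_dia_sigma canonical_dia_pi
    unfolding sigma_canonical_def pi_canonical_def canon_frame_sigma_def canon_frame_pi_def
    by (metis nframe.select_convs)
  show ?thesis
    unfolding LPP_def
  proof (intro allI impI)
    fix ps rs \<phi>
    assume "distinct (ps @ rs)" "vars \<phi> \<subseteq> set (ps @ rs)" "monotone_in L ps rs \<phi>"
    from ext_closed_if_monotone_in[OF F assms(3) this]
    obtain \<alpha> where "\<alpha> \<in> positive_fragment ps rs" "Iff \<phi> \<alpha> \<in> L"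
      by (rule definable_in_fragment[OF fragment_positive_fragment])
    then show "\<exists>\<alpha>. vars \<alpha> \<subseteq> set (ps @ rs) \<and> positive_in ps \<alpha> \<and> Iff \<phi> \<alpha> \<in> L"
      by (auto simp: positive_fragment_def)
  qed
qed

end
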